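(* Let $\mathcal{H}$ be a complete hypothesis set for binary classification and let $\Phi\colon \mathbb{R}\to\mathbb{R}_+$ be a non-decreasing function. Assume that $\Phi$ is convex, twice continuously differentiable, and satisfies $\Phi'(0)>0$ and $\Phi''(0)>0$. Let $\mathcal{T}\colon[0,1]\to\mathbb{R}$ be the $\mathcal{H}$-estimation error transformation function of the margin-based loss $\ell(h,x,y)=\Phi(-yh(x))$, that is, $$\mathcal{T}(t)=\inf_{u\le 0} f_t(u)-\inf_{u\in\mathbb{R}} f_t(u),\qquad f_t(u)=\frac{1-t}{2}\Phi(u)+\frac{1+t}{2}\Phi(-u).$$ Then $\mathcal{T}(t)=\Theta(t^2)$; that is, there exist positive constants $C>0$, $c>0$ and $T>0$ such that $C t^2\ge \mathcal{T}(t)\ge c\,t^2$ for all $0<t\le T$.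
   Context: Binary classification: input space $\mathcal{X}$, label space $\{-1,+1\}$; a hypothesis set $\mathcal{H}$ is a family of measurable functions $h\colon\mathcal{X}\to\mathbb{R}$. $\mathcal{H}$ is complete if $\{h(x)\colon h\in\mathcal{H}\}=\mathbb{R}$ for every $x\in\mathcal{X}$. The $\mathcal{H}$-estimation error transformation function of a surrogate loss $\ell$ is the tight function $\mathcal{T}$ such that, for all distributions and all $h\in\mathcal{H}$, $\mathcal{T}$ of (zero-one estimation error of $h$ plus zero-one minimizability gap) is at most the surrogate estimation error of $h$ plus the surrogate minimizability gap. For margin-based losses and complete $\mathcal{H}$ it is known to be given by the explicit formula displayed in the claim, which is to be taken as the definition of $\mathcal{T}$ here. *)

theory Defs
  imports "HOL-Analysis.Analysis"
begin

definition hypothesis_set :: "'x measure \<Rightarrow> ('x \<Rightarrow> real) set \<Rightarrow> bool" where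
  "hypothesis_set X H \<longleftrightarrow> H \<subseteq> borel_measurable X"

definition complete_hypothesis_set :: "'x measure \<Rightarrow> ('x \<Rightarrow> real) set \<Rightarrow> bool" where
  "complete_hypothesis_set X H \<longleftrightarrow>
     hypothesis_set X H \<and> (\<forall>x\<in>space X. {h x |h. h \<in> H} = UNIV)"

definition twice_continuously_differentiable :: "(real \<Rightarrow> real) \<Rightarrow> bool" where
  "twice_continuously_differentiable f \<longleftrightarrow>
     (\<forall>x. f differentiable (at x)) \<and>
     (\<forall>x. deriv f differentiable (at x)) \<and>
     continuous_on UNIV (deriv (deriv f))"

text \<open>
  For the margin-based loss $\ell(h,x,y) = \Phi(-y\,h(x))$, the value of \<open>cond_risk \<Phi> t u\<close> is the
  conditional risk of the prediction \<open>u\<close> at a point where the label is \<open>+1\<close> with probability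
  \<open>(1 + t) / 2\<close>.
\<close>

definition cond_risk :: "(real \<Rightarrow> real) \<Rightarrow> real \<Rightarrow> real \<Rightarrow> real" where
  "cond_risk \<Phi> t u = (1 - t) / 2 * \<Phi> u + (1 + t) / 2 * \<Phi> (- u)"

text \<open>
  For a complete hypothesis set the estimation error transformation function of the margin-based
  loss is given by the following formula, which does not depend on the hypothesis set.  It is
  meaningful for \<open>0 \<le> t \<le> 1\<close> and \<open>\<Phi> \<ge> 0\<close>: then \<open>cond_risk \<Phi> t\<close> is bounded below by \<open>0\<close>, so
  both infima are genuine.
\<close>

definition error_transformation :: "(real \<Rightarrow> real) \<Rightarrow> real \<Rightarrow> real" where
  "error_transformation \<Phi> t = (INF u\<in>{..0}. cond_risk \<Phi> t u) - (INF u. cond_risk \<Phi> t u)"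

end

theory Submission
  imports Defs
begin

text \<open>
  Write \<open>f\<^sub>t\<close> for the conditional risk. Convexity gives \<open>f\<^sub>t(u) \<ge> \<Phi>(0) - t \<Phi>'(0) u\<close>, so the
  infimum over \<open>u \<le> 0\<close> is \<open>\<Phi>(0)\<close>. Near \<open>0\<close>, Taylor's formula puts \<open>f\<^sub>t(u)\<close> between the parabolas
  \<open>\<Phi>(0) - t \<Phi>'(0) u + m u\<^sup>2 / 2\<close> and \<open>\<Phi>(0) - t \<Phi>'(0) u + M u\<^sup>2 / 2\<close> with
  \<open>0 < m \<le> \<Phi>'' \<le> M\<close>, whose minima lie a multiple of \<open>t\<^sup>2\<close> below \<open>\<Phi>(0)\<close>. For small \<open>t\<close>, convexity
  keeps \<open>f\<^sub>t\<close> above \<open>\<Phi>(0)\<close> outside the neighbourhood.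
\<close>

text \<open>Continuity of the second derivative keeps it between \<open>m\<close> and
  \<open>M\<close> near 0, and the Lagrange remainder of order two turns this into parabolas. The
  strict inequalities at 0 provide the room for a whole neighbourhood.\<close>

lemma twice_continuously_differentiable_quadratic_bounds:
  fixes f :: "real \<Rightarrow> real"
  assumes f: "twice_continuously_differentiable f"
    and m: "m < deriv (deriv f) 0" and M: "deriv (deriv f) 0 < M"
  obtains d where "d > 0"
    and "\<And>u. \<bar>u\<bar> \<le> d \<Longrightarrow> f 0 + deriv f 0 * u + m / 2 * u\<^sup>2 \<le> f u"
    and "\<And>u. \<bar>u\<bar> \<le> d \<Longrightarrow> f u \<le> f 0 + deriv f 0 * u + M / 2 * u\<^sup>2"
proof -
  let ?g = "deriv (deriv f)"
  have D1: "(f has_real_derivative deriv f x) (at x)" for x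
    using f by (simp add: twice_continuously_differentiable_def DERIV_deriv_iff_real_differentiable)
  have D2: "(deriv f has_real_derivative ?g x) (at x)" for x
    using f by (simp add: twice_continuously_differentiable_def DERIV_deriv_iff_real_differentiable)
  have "isCont ?g 0"
    using f by (simp add: twice_continuously_differentiable_def continuous_on_eq_continuous_at)
  then have "?g \<midarrow>0\<rightarrow> ?g 0"
    by (simp add: isCont_def)
  then have "\<forall>\<^sub>F x in at 0. m < ?g x \<and> ?g x < M"
    using m M by (intro eventually_conj order_tendstoD)
  then obtain e where e: "e > 0" "\<And>x. x \<noteq> 0 \<Longrightarrow> \<bar>x\<bar> < e \<Longrightarrow> m < ?g x \<and> ?g x < M"
    by (auto simp: eventually_at)
  \<comment> \<open>Halving \<open>e\<close> fits a closed interval inside the open one; the point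
    0, left out by the punctured limit, is covered by \<open>m\<close> and \<open>M\<close>
    themselves.\<close>
  have g: "m \<le> ?g x \<and> ?g x \<le> M" if "\<bar>x\<bar> \<le> e / 2" for x
    using that e m M by (cases "x = 0") (force, smt (verit) field_sum_of_halves)
  \<comment> \<open>The derivatives as a sequence, the form Maclaurin's theorem takes; only indices
    up to 2 matter, so the value beyond is arbitrary.\<close>
  define diff where "diff = (\<lambda>n::nat. if n = 0 then f else if n = 1 then deriv f else ?g)"
  have taylor: "\<exists>t. \<bar>t\<bar> \<le> \<bar>u\<bar> \<and> f u = f 0 + deriv f 0 * u + ?g t / 2 * u\<^sup>2" for u
  proof -
    have "\<exists>t. \<bar>t\<bar> \<le> \<bar>u\<bar> \<and> f u = (\<Sum>k<2. diff k 0 / fact k * u ^ k) + diff 2 t / fact 2 * u ^ 2"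
      by (rule Maclaurin_bi_le) (auto simp: diff_def less_2_cases_iff D1 D2)
    then show ?thesis
      by (simp add: diff_def numeral_2_eq_2)
  qed
  show ?thesis
  proof (rule that[of "e / 2"])
    show "e / 2 > 0" using e by simp
    fix u assume u: "\<bar>u\<bar> \<le> e / 2"
    obtain t where t: "\<bar>t\<bar> \<le> \<bar>u\<bar>" "f u = f 0 + deriv f 0 * u + ?g t / 2 * u\<^sup>2"
      using taylor by blast
    have "m \<le> ?g t \<and> ?g t \<le> M" using g t(1) u by auto
    then have "m / 2 * u\<^sup>2 \<le> ?g t / 2 * u\<^sup>2" "?g t / 2 * u\<^sup>2 \<le> M / 2 * u\<^sup>2"
      by (auto intro!: mult_right_mono)
    then show "f 0 + deriv f 0 * u + m / 2 * u\<^sup>2 \<le> f u"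
      and "f u \<le> f 0 + deriv f 0 * u + M / 2 * u\<^sup>2"
      using t(2) by auto
  qed
qed

lemma cond_risk_0: "cond_risk \<Phi> t 0 = \<Phi> 0"
  by (simp add: cond_risk_def field_simps)

text \<open>The weights at \<open>u\<close> and \<open>- u\<close> are nonnegative with sum 1 and
  difference \<open>- t\<close>: averaging keeps the even terms and scales the linear one by
  \<open>- t\<close>.\<close>

lemma cond_risk_ge_parabola:
  assumes "0 \<le> t" "t \<le> 1"
    and "\<Phi> 0 + a * u + k * u\<^sup>2 \<le> \<Phi> u" "\<Phi> 0 + a * (- u) + k * (- u)\<^sup>2 \<le> \<Phi> (- u)"
  shows "\<Phi> 0 - t * a * u + k * u\<^sup>2 \<le> cond_risk \<Phi> t u"
proof -
  have "(1 - t) / 2 * (\<Phi> 0 + a * u + k * u\<^sup>2) + (1 + t) / 2 * (\<Phi> 0 + a * (- u) + k * (- u)\<^sup>2)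
      \<le> cond_risk \<Phi> t u"
    unfolding cond_risk_def using assms by (intro add_mono mult_left_mono) auto
  then show ?thesis by (simp add: field_simps)
qed

lemma cond_risk_le_parabola:
  assumes "0 \<le> t" "t \<le> 1"
    and "\<Phi> u \<le> \<Phi> 0 + a * u + k * u\<^sup>2" "\<Phi> (- u) \<le> \<Phi> 0 + a * (- u) + k * (- u)\<^sup>2"
  shows "cond_risk \<Phi> t u \<le> \<Phi> 0 - t * a * u + k * u\<^sup>2"
proof -
  have "cond_risk \<Phi> t u \<le> (1 - t) / 2 * (\<Phi> 0 + a * u + k * u\<^sup>2)
      + (1 + t) / 2 * (\<Phi> 0 + a * (- u) + k * (- u)\<^sup>2)"
    unfolding cond_risk_def using assms by (intro add_mono mult_left_mono) auto
  then show ?thesis by (simp add: field_simps)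
qed

lemma convex_on_cond_risk:
  assumes "convex_on UNIV \<Phi>" "0 \<le> t" "t \<le> 1"
  shows "convex_on UNIV (cond_risk \<Phi> t)"
proof -
  have "convex_on UNIV (\<lambda>u. \<Phi> (- u))"
  proof (rule convex_onI)
    fix s x y :: real assume "0 < s" "s < 1"
    then show "\<Phi> (- ((1 - s) *\<^sub>R x + s *\<^sub>R y)) \<le> (1 - s) * \<Phi> (- x) + s * \<Phi> (- y)"
      using convex_onD[OF assms(1), of s "- x" "- y"] by (simp add: algebra_simps)
  qed simp
  then show ?thesis
    unfolding cond_risk_def[abs_def] using assms
    by (intro convex_on_add convex_on_cmul) auto
qed

text \<open>As \<open>d\<close> is a convex combination of 0 and \<open>u\<close>, a value at
  \<open>u\<close> below \<open>f 0\<close> would force one at \<open>d\<close> below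
  \<open>f 0\<close>.\<close>

lemma convex_on_ge_beyond:
  fixes f :: "real \<Rightarrow> real"
  assumes "convex_on UNIV f" "f 0 \<le> f d" "0 < d" "d \<le> u"
  shows "f 0 \<le> f u"
proof -
  have "f ((1 - d / u) *\<^sub>R 0 + (d / u) *\<^sub>R u) \<le> (1 - d / u) * f 0 + (d / u) * f u"
    using assms by (intro convex_onD) auto
  then have "f d \<le> (1 - d / u) * f 0 + (d / u) * f u"
    using assms by simp
  then have "0 \<le> (d / u) * (f u - f 0)"
    using assms(2) by (simp add: algebra_simps)
  then show ?thesis
    using assms by (simp add: zero_le_mult_iff zero_le_divide_iff)
qed

text \<open>Completing the square about the vertex \<open>b / (2 * k)\<close>.\<close>

lemma parabola_ge_vertex:
  fixes b k u :: real
  assumes "k > 0"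
  shows "- (b\<^sup>2 / (4 * k)) \<le> - b * u + k * u\<^sup>2"
proof -
  have "- b * u + k * u\<^sup>2 + b\<^sup>2 / (4 * k) = k * (u - b / (2 * k))\<^sup>2"
    using assms by (simp add: field_simps power2_eq_square)
  also have "\<dots> \<ge> 0" using assms by simp
  finally show ?thesis by simp
qed

lemma cond_risk_ge_left:
  assumes "0 \<le> t" "t \<le> 1" "0 \<le> a" and tangent: "\<And>u. \<Phi> 0 + a * u \<le> \<Phi> u" and "u \<le> 0"
  shows "\<Phi> 0 \<le> cond_risk \<Phi> t u"
proof -
  \<comment> \<open>Curvature 0 reduces the parabola bound to the tangent line.\<close>
  have "\<Phi> 0 - t * a * u + 0 * u\<^sup>2 \<le> cond_risk \<Phi> t u"
    using assms(1,2) tangent[of u] tangent[of "- u"] by (intro cond_risk_ge_parabola) auto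
  moreover have "t * a * u \<le> 0"
    using assms by (simp add: mult_nonneg_nonpos)
  ultimately show ?thesis by simp
qed

lemma error_transformation_eq:
  assumes "0 \<le> t" "t \<le> 1" "0 \<le> a" and "\<And>u. \<Phi> 0 + a * u \<le> \<Phi> u"
  shows "error_transformation \<Phi> t = \<Phi> 0 - (INF u. cond_risk \<Phi> t u)"
proof -
  have "(INF u\<in>{..0}. cond_risk \<Phi> t u) = \<Phi> 0"
    by (rule cInf_eq_minimum)
      (auto intro!: image_eqI[of _ _ 0] cond_risk_ge_left[OF assms] simp: cond_risk_0)
  then show ?thesis by (simp add: error_transformation_def)
qed

theorem theorem5:
  fixes X :: "'x measure" and H :: "('x \<Rightarrow> real) set" and \<Phi> :: "real \<Rightarrow> real"
  assumes "complete_hypothesis_set X H"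
    and "\<And>u. 0 \<le> \<Phi> u"
    and "mono \<Phi>"
    and "convex_on UNIV \<Phi>"
    and "twice_continuously_differentiable \<Phi>"
    and "deriv \<Phi> 0 > 0"
    and "deriv (deriv \<Phi>) 0 > 0"
  shows "\<exists>C c T :: real. C > 0 \<and> c > 0 \<and> 0 < T \<and> T \<le> 1 \<and>
           (\<forall>t. 0 < t \<and> t \<le> T \<longrightarrow>
              C * t\<^sup>2 \<ge> error_transformation \<Phi> t \<and> error_transformation \<Phi> t \<ge> c * t\<^sup>2)"
proof -
  define a where "a = deriv \<Phi> 0"
  \<comment> \<open>The factors give \<open>2 * k < \<Phi>''(0) < 2 * K\<close> strictly, as the
    quadratic bounds require.\<close>
  define k K where "k = deriv (deriv \<Phi>) 0 / 4" and "K = deriv (deriv \<Phi>) 0"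
  have pos: "a > 0" "k > 0" "K > 0"
    using assms by (auto simp: a_def k_def K_def)
  obtain d where d: "d > 0"
    and lower: "\<And>u. \<bar>u\<bar> \<le> d \<Longrightarrow> \<Phi> 0 + a * u + k * u\<^sup>2 \<le> \<Phi> u"
    and upper: "\<And>u. \<bar>u\<bar> \<le> d \<Longrightarrow> \<Phi> u \<le> \<Phi> 0 + a * u + K * u\<^sup>2"
    using twice_continuously_differentiable_quadratic_bounds[OF assms(5), of "2 * k" "2 * K"] pos
    by (auto simp: a_def k_def K_def)
  have "(\<Phi> has_real_derivative a) (at 0)"
    using assms(5)
    by (simp add: a_def twice_continuously_differentiable_def DERIV_deriv_iff_real_differentiable)
  then have tangent: "\<Phi> 0 + a * u \<le> \<Phi> u" for u
    using convex_on_imp_above_tangent[OF assms(4), of 0 u a] by simp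
  \<comment> \<open>The bound 1 keeps the weights nonnegative, \<open>k * d / a\<close> lifts the
    lower parabola to at least \<open>\<Phi> 0\<close> at \<open>d\<close>, and
    \<open>2 * K * d / a\<close> keeps the vertex of the upper one within distance \<open>d\<close>
    of 0.\<close>
  define T where "T = min 1 (min (k * d / a) (2 * K * d / a))"
  have "0 < T" "T \<le> 1"
    using pos d by (auto simp: T_def)
  have "a\<^sup>2 / (4 * K) * t\<^sup>2 \<le> error_transformation \<Phi> t
      \<and> error_transformation \<Phi> t \<le> a\<^sup>2 / (4 * k) * t\<^sup>2" if t: "0 < t" "t \<le> T" for t
  proof -
    have t1: "0 \<le> t" "t \<le> 1" and tk: "t * a \<le> k * d" and tK: "t * a \<le> 2 * K * d"
      using t pos by (auto simp: T_def pos_le_divide_eq)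
    have low: "\<Phi> 0 - t * a * u + k * u\<^sup>2 \<le> cond_risk \<Phi> t u" if "\<bar>u\<bar> \<le> d" for u
      using that by (intro cond_risk_ge_parabola t1 lower) auto
    have "t * a * d \<le> k * d * d"
      using tk d by (intro mult_right_mono) auto
    then have "cond_risk \<Phi> t 0 \<le> cond_risk \<Phi> t d"
      using low[of d] d unfolding cond_risk_0 power2_eq_square mult.assoc by linarith
    then have far: "\<Phi> 0 \<le> cond_risk \<Phi> t u" if "d \<le> u" for u
      using convex_on_ge_beyond[OF convex_on_cond_risk[OF assms(4) t1] _ d that]
      by (simp add: cond_risk_0)
    have low_all: "\<Phi> 0 - a\<^sup>2 / (4 * k) * t\<^sup>2 \<le> cond_risk \<Phi> t u" for u
    proof (cases "\<bar>u\<bar> \<le> d")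
      case True
      then show ?thesis
        using low[of u] parabola_ge_vertex[OF pos(2), of "t * a" u]
        by (simp add: power_mult_distrib mult.commute)
    next
      \<comment> \<open>Either \<open>u < - d\<close>, where the tangent bound for
        \<open>u \<le> 0\<close> applies, or \<open>u > d\<close>, where convexity does.\<close>
      case False
      then have "\<Phi> 0 \<le> cond_risk \<Phi> t u"
        using cond_risk_ge_left[OF t1 less_imp_le[OF pos(1)] tangent, of u] far[of u] by linarith
      moreover have "0 \<le> a\<^sup>2 / (4 * k) * t\<^sup>2" using pos by simp
      ultimately show ?thesis by linarith
    qed
    \<comment> \<open>The vertex of the upper parabola, where its minimum bounds the infimum from
      above.\<close>
    define v where "v = t * a / (2 * K)"
    have v: "\<bar>v\<bar> \<le> d"
      using tK pos t1 by (simp add: v_def pos_divide_le_eq mult.commute mult.left_commute)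
    have "(INF u. cond_risk \<Phi> t u) \<le> cond_risk \<Phi> t v"
      by (rule cINF_lower) (auto intro!: bdd_belowI2 low_all)
    also have "\<dots> \<le> \<Phi> 0 - t * a * v + K * v\<^sup>2"
      using v by (intro cond_risk_le_parabola t1 upper) auto
    also have "\<dots> = \<Phi> 0 - a\<^sup>2 / (4 * K) * t\<^sup>2"
      using pos by (simp add: v_def field_simps power2_eq_square)
    finally have "(INF u. cond_risk \<Phi> t u) \<le> \<Phi> 0 - a\<^sup>2 / (4 * K) * t\<^sup>2" .
    moreover have "\<Phi> 0 - a\<^sup>2 / (4 * k) * t\<^sup>2 \<le> (INF u. cond_risk \<Phi> t u)"
      by (intro cINF_greatest low_all) simp
    moreover have "error_transformation \<Phi> t = \<Phi> 0 - (INF u. cond_risk \<Phi> t u)"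
      using error_transformation_eq[where a = a] t1 pos tangent by auto
    ultimately show ?thesis by linarith
  qed
  \<comment> \<open>The smaller curvature \<open>k\<close> gives the deeper vertex and hence the
    upper constant; \<open>K\<close> gives the lower one.\<close>
  then show ?thesis
    using pos \<open>0 < T\<close> \<open>T \<le> 1\<close>
    by (intro exI[of _ "a\<^sup>2 / (4 * k)"] exI[of _ "a\<^sup>2 / (4 * K)"] exI[of _ T]) auto
qed

end
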